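(* Let $n \ge 2$ and $C \ge 2$, and let $P_1,\dots,P_n$ be pairwise distinct probability distributions on a set of $C$ colors, $P_i = (p_{i,1},\dots,p_{i,C})$. Let $\epsilon = \min_{i\ne j}\sum_{c=1}^C |p_{i,c}-p_{j,c}|$. Then for every $\eta \in (0,1)$ there exists a plurality voting scheme that, using $m = \Theta\left(\frac{(C\log C)^2 n^3}{\epsilon^2}\ln\frac{n}{\eta}\right)$ voters (with absolute implicit constants), guarantees that, whichever urn is the correct one, the correct urn receives strictly more votes than every other urn with probability at least $1-\eta$.
   Context: Voting model: urn $i$ produces color $c$ with probability $p_{i,c}$. One urn is chosen (adversarially) as the correct urn. Each of $m$ voters independently draws one ball (with replacement) from the correct urn, observes only its color, and casts a vote for exactly one urn according to a possibly randomized rule mapping the observed color to a probability distribution over the $n$ urns; the randomness of different voters is independent. A voting scheme is a specification of these rules (it may depend on $P_1,\dots,P_n$ but not on which urn is correct). Under plurality voting, the votes for each urn are counted. *)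

theory Defs
  imports "HOL-Probability.Probability" "HOL-Probability.Product_PMF"
begin

text \<open>
  Urns are numbered \<open>1, \<dots>, n\<close>, colors \<open>1, \<dots>, C\<close> and voters \<open>1, \<dots>, m\<close>. These are ranges of
  natural numbers rather than finite types because the absolute constants have to be quantified
  outside of \<open>n\<close> and \<open>C\<close>.
\<close>

definition urn_family :: "nat \<Rightarrow> nat \<Rightarrow> (nat \<Rightarrow> nat pmf) \<Rightarrow> bool" where
  "urn_family n C P \<longleftrightarrow> (\<forall>i\<in>{1..n}. set_pmf (P i) \<subseteq> {1..C}) \<and> inj_on P {1..n}"

definition min_l1_dist :: "nat \<Rightarrow> nat \<Rightarrow> (nat \<Rightarrow> nat pmf) \<Rightarrow> real" where
  "min_l1_dist n C P =
     Min {\<Sum>c=1..C. \<bar>pmf (P i) c - pmf (P j) c\<bar> | i j. i \<in> {1..n} \<and> j \<in> {1..n} \<and> i \<noteq> j}"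

text \<open>\<open>\<sigma> k c\<close> is the distribution of the vote of voter \<open>k\<close> after observing the color \<open>c\<close>.\<close>

definition voting_scheme :: "nat \<Rightarrow> nat \<Rightarrow> nat \<Rightarrow> (nat \<Rightarrow> nat \<Rightarrow> nat pmf) \<Rightarrow> bool" where
  "voting_scheme n C m \<sigma> \<longleftrightarrow> (\<forall>k\<in>{1..m}. \<forall>c\<in>{1..C}. set_pmf (\<sigma> k c) \<subseteq> {1..n})"

definition cast_vote :: "nat pmf \<Rightarrow> (nat \<Rightarrow> nat pmf) \<Rightarrow> nat pmf" where
  "cast_vote Q r = do {c \<leftarrow> Q; r c}"

text \<open>
  Joint distribution of all votes when the correct urn has color distribution \<open>Q\<close>. The value \<open>0\<close>
  is only the default outside of the set of voters.
\<close>

definition ballots :: "nat \<Rightarrow> (nat \<Rightarrow> nat \<Rightarrow> nat pmf) \<Rightarrow> nat pmf \<Rightarrow> (nat \<Rightarrow> nat) pmf" where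
  "ballots m \<sigma> Q = Pi_pmf {1..m} 0 (\<lambda>k. cast_vote Q (\<sigma> k))"

definition vote_count :: "nat \<Rightarrow> (nat \<Rightarrow> nat) \<Rightarrow> nat \<Rightarrow> nat" where
  "vote_count m v j = card {k \<in> {1..m}. v k = j}"

definition plurality_winner :: "nat \<Rightarrow> nat \<Rightarrow> (nat \<Rightarrow> nat) \<Rightarrow> nat \<Rightarrow> bool" where
  "plurality_winner n m v i \<longleftrightarrow> (\<forall>j\<in>{1..n} - {i}. vote_count m v j < vote_count m v i)"

definition voter_bound :: "nat \<Rightarrow> nat \<Rightarrow> real \<Rightarrow> real \<Rightarrow> real" where
  "voter_bound n C \<epsilon> \<eta> =
     (real C * ln (real C))\<^sup>2 * real n ^ 3 / \<epsilon>\<^sup>2 * ln (real n / \<eta>)"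

end

theory Submission
  imports Defs
begin

text \<open>
  For each ordered pair \<open>(j, k)\<close> of urns the Scheffe statistic
  \<open>T\<^sub>j\<^sub>k(Q) = \<Sum>c. sgn (P\<^sub>j c - P\<^sub>k c) * (Q c - P\<^sub>k c)\<close> is affine in \<open>Q\<close>, so it is the
  expectation of a bounded function of the observed color. Let the score of urn \<open>j\<close> be
  \<open>\<Sum>k. T\<^sub>j\<^sub>k\<close>. If \<open>Q = P\<^sub>i\<close>, then \<open>T\<^sub>j\<^sub>k \<le> \<parallel>P\<^sub>i - P\<^sub>k\<parallel>\<^sub>1 = T\<^sub>i\<^sub>k\<close> for all \<open>k\<close>, and for \<open>k = j\<close>
  the difference is \<open>\<parallel>P\<^sub>i - P\<^sub>j\<parallel>\<^sub>1 \<ge> \<epsilon>\<close>; hence the expected score of the correct urn exceeds all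
  others by at least \<open>\<epsilon>\<close>. A voter who perturbs the uniform vote by the normalised scores of
  the observed color votes for every urn with probability at most \<open>2 / n\<close>, and for the correct
  one with a margin of \<open>\<epsilon> / (4 n\<^sup>2)\<close>. A Chernoff bound that exploits the small variance \<open>O(1 / n)\<close>
  shows that already \<open>256 n\<^sup>3 / \<epsilon>\<^sup>2 * ln (n / \<eta>)\<close> voters suffice; the factor \<open>(C ln C)\<^sup>2\<close> only
  increases their number.
\<close>

section \<open>Chernoff bound for the difference of two vote counts\<close>

text \<open>The product \<open>(1 + t) * (1 - t + t\<^sup>2)\<close> equals
  \<open>1 + t\<^sup>3\<close>, hence is at least 1, and \<open>1 + t \<le> exp t\<close>.\<close>

lemma exp_minus_le_quadratic:
  fixes t :: real
  assumes "0 \<le> t"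
  shows "exp (- t) \<le> 1 - t + t\<^sup>2"
proof -
  have "1 \<le> (1 + t) * (1 - t + t\<^sup>2)"
    using assms by (simp add: algebra_simps power2_eq_square)
  also have "\<dots> \<le> exp t * (1 - t + t\<^sup>2)"
  proof (rule mult_right_mono)
    have "1 - t + t\<^sup>2 = (t - 1/2)\<^sup>2 + 3/4"
      by (simp add: power2_eq_square algebra_simps)
    then show "0 \<le> 1 - t + t\<^sup>2" by simp
  qed simp
  finally show ?thesis by (simp add: exp_minus field_simps)
qed

text \<open>Here \<open>f\<close> is the factor that one vote contributes to
  \<open>exp (t * (votes for j - votes for i))\<close>. Expanding both exponentials to second order
  gives the drift \<open>- t * \<Delta>\<close> and the error \<open>t\<^sup>2 * s\<close>. Having
  \<open>s\<close> there instead of a constant is what later saves a factor of order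
  \<open>n\<close>.\<close>

lemma expectation_exp_vote_difference_le:
  fixes Q :: "nat pmf" and t \<Delta> s :: real
  assumes "i \<noteq> j" "0 \<le> t" "t \<le> 1" "\<Delta> \<le> pmf Q i - pmf Q j" "pmf Q i + pmf Q j \<le> s"
  defines "f \<equiv> (\<lambda>x. if x = j then exp t else if x = i then exp (- t) else 1)"
  shows "measure_pmf.expectation Q f \<le> exp (- (t * \<Delta>) + t\<^sup>2 * s)"
proof -
  have f: "f = (\<lambda>x. 1 + ((exp t - 1) * indicator {j} x + (exp (- t) - 1) * indicator {i} x))"
    using assms(1) by (auto simp: f_def fun_eq_iff indicator_def)
  have "measure_pmf.expectation Q f = 1 + ((exp t - 1) * pmf Q j + (exp (- t) - 1) * pmf Q i)"
  proof -
    have "integrable (measure_pmf Q) (\<lambda>x. a * indicator {k} x)" for a :: real and k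
      by (rule measure_pmf.integrable_const_bound[where B = "\<bar>a\<bar>"])
         (auto simp: indicator_def)
    then show ?thesis
      unfolding f by (simp add: measure_pmf_single)
  qed
  also have "\<dots> \<le> 1 + ((t + t\<^sup>2) * pmf Q j + (- t + t\<^sup>2) * pmf Q i)"
    using exp_bound[OF assms(2,3)] exp_minus_le_quadratic[OF assms(2)]
    by (intro add_left_mono add_mono mult_right_mono) auto
  also have "\<dots> = 1 + (- (t * (pmf Q i - pmf Q j)) + t\<^sup>2 * (pmf Q i + pmf Q j))"
    by (simp add: algebra_simps)
  also have "\<dots> \<le> 1 + (- (t * \<Delta>) + t\<^sup>2 * s)"
    using assms by (intro add_left_mono add_mono) (auto intro!: mult_left_mono)
  also have "\<dots> \<le> exp (- (t * \<Delta>) + t\<^sup>2 * s)"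
    by (rule exp_ge_add_one_self)
  finally show ?thesis .
qed

text \<open>Markov's inequality at threshold 1 for the exponential of the vote difference, whose
  expectation factorises over the independent voters. Ties belong to the bad event, because a winner
  needs strictly more votes.\<close>

lemma prob_vote_count_le:
  fixes Q :: "nat pmf" and t \<Delta> s :: real
  assumes "i \<noteq> j" "0 \<le> t" "t \<le> 1" "\<Delta> \<le> pmf Q i - pmf Q j" "pmf Q i + pmf Q j \<le> s"
  shows "measure_pmf.prob (Pi_pmf {1..m} 0 (\<lambda>_. Q)) {v. vote_count m v i \<le> vote_count m v j}
           \<le> exp (real m * (- (t * \<Delta>) + t\<^sup>2 * s))"
proof -
  define f where "f = (\<lambda>x. if x = j then exp t else if x = i then exp (- t) else 1)"
  define M where "M = Pi_pmf {1..m} 0 (\<lambda>_. Q)"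
  have int: "integrable (measure_pmf Q) f"
    by (rule measure_pmf.integrable_const_bound[where B = "exp t"])
       (use assms(2) in \<open>auto simp: f_def\<close>)
  have prod_f: "(\<Prod>k\<in>{1..m}. f (v k)) =
      exp (t * (real (vote_count m v j) - real (vote_count m v i)))" for v
  proof -
    have "(\<Prod>k\<in>{1..m}. f (v k)) =
        exp (\<Sum>k\<in>{1..m}. t * ((if v k = j then 1 else 0) - (if v k = i then 1 else 0)))"
      unfolding exp_sum[OF finite_atLeastAtMost] using assms(1)
      by (intro prod.cong) (auto simp: f_def)
    also have "(\<Sum>k\<in>{1..m}. t * ((if v k = j then 1 else 0) - (if v k = i then 1 else 0))) =
        t * (real (vote_count m v j) - real (vote_count m v i))"
      by (simp add: vote_count_def sum_subtractf flip: sum_distrib_left sum.inter_filter)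
    finally show ?thesis .
  qed
  have "measure_pmf.prob M {v. vote_count m v i \<le> vote_count m v j}
      \<le> measure_pmf.prob M {v \<in> space M. 1 \<le> (\<Prod>k\<in>{1..m}. f (v k))}"
    using assms(2) by (intro measure_pmf.finite_measure_mono) (auto simp: prod_f simp del: One_nat_def)
  also have "\<dots> \<le> measure_pmf.expectation M (\<lambda>v. \<Prod>k\<in>{1..m}. f (v k)) / 1"
    unfolding M_def using int
    by (intro integral_Markov_inequality_measure[where A = UNIV] integrable_prod_Pi_pmf)
       (auto simp: f_def intro!: prod_nonneg)
  also have "\<dots> = measure_pmf.expectation Q f ^ m"
    unfolding M_def using int by (subst expectation_prod_Pi_pmf) (auto simp: f_def)
  also have "\<dots> \<le> exp (- (t * \<Delta>) + t\<^sup>2 * s) ^ m"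
    unfolding f_def
    by (intro power_mono expectation_exp_vote_difference_le assms integral_nonneg_AE) auto
  also have "\<dots> = exp (real m * (- (t * \<Delta>) + t\<^sup>2 * s))"
    by (rule exp_of_nat_mult[symmetric])
  finally show ?thesis by (simp add: M_def)
qed

text \<open>Union bound over the competitors of \<open>i\<close>; their number \<open>n - 1\<close>
  is rounded up to \<open>n\<close>.\<close>

lemma prob_plurality_winner_ge:
  fixes Q :: "nat pmf" and t \<Delta> s :: real
  assumes "i \<in> {1..n}" "0 \<le> t" "t \<le> 1"
    and gap: "\<And>j. j \<in> {1..n} \<Longrightarrow> j \<noteq> i \<Longrightarrow> \<Delta> \<le> pmf Q i - pmf Q j"
    and small: "\<And>j. j \<in> {1..n} \<Longrightarrow> j \<noteq> i \<Longrightarrow> pmf Q i + pmf Q j \<le> s"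
  shows "measure_pmf.prob (Pi_pmf {1..m} 0 (\<lambda>_. Q)) {v. plurality_winner n m v i}
           \<ge> 1 - real n * exp (real m * (- (t * \<Delta>) + t\<^sup>2 * s))"
proof -
  define M where "M = Pi_pmf {1..m} 0 (\<lambda>_. Q)"
  let ?e = "exp (real m * (- (t * \<Delta>) + t\<^sup>2 * s))"
  have "measure_pmf.prob M (- {v. plurality_winner n m v i}) =
      measure_pmf.prob M (\<Union>j\<in>{1..n} - {i}. {v. vote_count m v i \<le> vote_count m v j})"
    by (intro arg_cong[where f = "measure_pmf.prob M"])
       (auto simp: plurality_winner_def simp flip: not_less)
  also have "\<dots> \<le> (\<Sum>j\<in>{1..n} - {i}.
      measure_pmf.prob M {v. vote_count m v i \<le> vote_count m v j})"
    by (intro measure_pmf.finite_measure_subadditive_finite) auto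
  also have "\<dots> \<le> (\<Sum>j\<in>{1..n} - {i}. ?e)"
    unfolding M_def using assms by (intro sum_mono prob_vote_count_le) auto
  also have "\<dots> \<le> real n * ?e"
    using assms(1) by (auto intro!: mult_right_mono)
  finally show ?thesis
    by (simp add: M_def measure_pmf.prob_compl[simplified] Compl_eq_Diff_UNIV)
qed

section \<open>Scheffe scores and their expectations\<close>

text \<open>An unbiased estimate of the sum over \<open>k\<close> of the statistics of the pairs
  \<open>(j, k)\<close>, from a single observed color \<open>d\<close>. The inner sum does not
  depend on \<open>d\<close>; it centres each statistic so that its mean is zero when
  \<open>d\<close> is drawn from \<open>P k\<close>.\<close>

definition scheffe_score :: "nat \<Rightarrow> nat \<Rightarrow> (nat \<Rightarrow> nat pmf) \<Rightarrow> nat \<Rightarrow> nat \<Rightarrow> real" where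
  "scheffe_score n C P j d = (\<Sum>k=1..n. sgn (pmf (P j) d - pmf (P k) d)
     - (\<Sum>c=1..C. sgn (pmf (P j) c - pmf (P k) c) * pmf (P k) c))"

lemma abs_sgn_mult_le: "\<bar>sgn x * y\<bar> \<le> \<bar>y\<bar>" for x y :: real
  by (auto simp: sgn_real_def abs_mult)

lemma abs_scheffe_score_le:
  assumes "urn_family n C P"
  shows "\<bar>scheffe_score n C P j d\<bar> \<le> 2 * real n"
proof -
  have "\<bar>sgn (pmf (P j) d - pmf (P k) d)
      - (\<Sum>c=1..C. sgn (pmf (P j) c - pmf (P k) c) * pmf (P k) c)\<bar> \<le> 2"
    if k: "k \<in> {1..n}" for k
  proof -
    have "\<bar>\<Sum>c=1..C. sgn (pmf (P j) c - pmf (P k) c) * pmf (P k) c\<bar> \<le> (\<Sum>c=1..C. \<bar>pmf (P k) c\<bar>)"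
      by (intro order_trans[OF sum_abs] sum_mono abs_sgn_mult_le)
    also have "\<dots> = 1"
      using assms k by (simp add: urn_family_def sum_pmf_eq_1)
    finally show ?thesis
      by (auto simp: sgn_real_def)
  qed
  then have "\<bar>scheffe_score n C P j d\<bar> \<le> (\<Sum>k=1..n. 2)"
    unfolding scheffe_score_def by (intro order_trans[OF sum_abs] sum_mono)
  then show ?thesis by simp
qed

lemma expected_scheffe_score:
  assumes "set_pmf Q \<subseteq> {1..C}"
  shows "(\<Sum>d=1..C. pmf Q d * scheffe_score n C P j d) =
    (\<Sum>k=1..n. \<Sum>c=1..C. sgn (pmf (P j) c - pmf (P k) c) * (pmf Q c - pmf (P k) c))"
proof -
  have Q: "(\<Sum>d=1..C. pmf Q d) = 1"
    using assms by (simp add: sum_pmf_eq_1)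
  have "(\<Sum>d=1..C. pmf Q d * scheffe_score n C P j d) =
      (\<Sum>k=1..n. \<Sum>d=1..C. pmf Q d * (sgn (pmf (P j) d - pmf (P k) d)
        - (\<Sum>c=1..C. sgn (pmf (P j) c - pmf (P k) c) * pmf (P k) c)))"
    unfolding scheffe_score_def sum_distrib_left by (rule sum.swap)
  also have "\<dots> = (\<Sum>k=1..n. \<Sum>c=1..C.
      sgn (pmf (P j) c - pmf (P k) c) * (pmf Q c - pmf (P k) c))"
  proof (rule sum.cong[OF refl])
    fix k
    define S where "S = (\<Sum>c=1..C. sgn (pmf (P j) c - pmf (P k) c) * pmf (P k) c)"
    have "(\<Sum>d=1..C. pmf Q d * (sgn (pmf (P j) d - pmf (P k) d) - S)) =
        (\<Sum>d=1..C. pmf Q d * sgn (pmf (P j) d - pmf (P k) d)) - S"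
      using Q by (simp add: right_diff_distrib sum_subtractf flip: sum_distrib_right)
    also have "\<dots> = (\<Sum>c=1..C. sgn (pmf (P j) c - pmf (P k) c) * (pmf Q c - pmf (P k) c))"
      unfolding S_def sum_subtractf[symmetric] by (intro sum.cong refl) (simp add: algebra_simps)
    finally show "(\<Sum>d=1..C. pmf Q d * (sgn (pmf (P j) d - pmf (P k) d)
        - (\<Sum>c=1..C. sgn (pmf (P j) c - pmf (P k) c) * pmf (P k) c))) =
      (\<Sum>c=1..C. sgn (pmf (P j) c - pmf (P k) c) * (pmf Q c - pmf (P k) c))"
      unfolding S_def .
  qed
  finally show ?thesis .
qed

lemma expected_scheffe_score_gap:
  assumes "urn_family n C P" "i \<in> {1..n}" "j \<in> {1..n}"
  shows "(\<Sum>c=1..C. \<bar>pmf (P i) c - pmf (P j) c\<bar>) \<le>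
    (\<Sum>d=1..C. pmf (P i) d * (scheffe_score n C P i d - scheffe_score n C P j d))"
proof -
  define T where "T = (\<lambda>j k. \<Sum>c=1..C.
    sgn (pmf (P j) c - pmf (P k) c) * (pmf (P i) c - pmf (P k) c))"
  have Ti: "T i k = (\<Sum>c=1..C. \<bar>pmf (P i) c - pmf (P k) c\<bar>)" for k
    unfolding T_def by (simp add: mult_sgn_abs abs_sgn mult.commute)
  have le: "T j k \<le> T i k" for k
    unfolding Ti unfolding T_def
    by (rule sum_mono) (rule order_trans[OF abs_ge_self abs_sgn_mult_le])
  \<comment> \<open>\<open>T j j\<close> vanishes, since each of its signs is
    \<open>sgn 0\<close>.\<close>
  have "(\<Sum>c=1..C. \<bar>pmf (P i) c - pmf (P j) c\<bar>) = T i j - T j j"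
    unfolding Ti by (simp add: T_def)
  \<comment> \<open>By \<open>le\<close> all summands are nonnegative, so the one with
    \<open>k = j\<close> is a lower bound for the sum.\<close>
  also have "\<dots> \<le> (\<Sum>k=1..n. T i k - T j k)"
    by (rule member_le_sum[of j "{1..n}" "\<lambda>k. T i k - T j k"]) (use assms(3) le in auto)
  also have "\<dots> = (\<Sum>d=1..C. pmf (P i) d * (scheffe_score n C P i d - scheffe_score n C P j d))"
  proof -
    have "set_pmf (P i) \<subseteq> {1..C}"
      using assms by (simp add: urn_family_def)
    then show ?thesis
      unfolding right_diff_distrib[of "pmf (P i) _"] sum_subtractf T_def
      by (simp only: expected_scheffe_score)
  qed
  finally show ?thesis .
qed

section \<open>The randomized voting rule\<close>

text \<open>Subtracting the mean score over all urns makes the perturbations cancel, so the weights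
  sum to 1. A score and the mean are each at most \<open>2 * n\<close> in absolute value, so
  dividing by \<open>4 * n\<close> brings the perturbation into \<open>[-1, 1]\<close>.\<close>

definition vote_weight :: "nat \<Rightarrow> nat \<Rightarrow> (nat \<Rightarrow> nat pmf) \<Rightarrow> nat \<Rightarrow> nat \<Rightarrow> real" where
  "vote_weight n C P d j = (if j \<in> {1..n} then
     (1 + (scheffe_score n C P j d - (\<Sum>k=1..n. scheffe_score n C P k d) / real n) / (4 * real n))
       / real n else 0)"

lemma vote_weight_bounds:
  assumes "urn_family n C P"
  shows "0 \<le> vote_weight n C P d j" "vote_weight n C P d j \<le> 2 / real n"
proof -
  have "0 \<le> vote_weight n C P d j \<and> vote_weight n C P d j \<le> 2 / real n"
  proof (cases "j \<in> {1..n}")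
    case True
    then have n: "real n > 0" by auto
    let ?g = "\<lambda>k. scheffe_score n C P k d"
    have "\<bar>\<Sum>k=1..n. ?g k\<bar> \<le> (\<Sum>k=1..n. 2 * real n)"
      by (intro order_trans[OF sum_abs] sum_mono abs_scheffe_score_le assms)
    then have "\<bar>(\<Sum>k=1..n. ?g k) / real n\<bar> \<le> 2 * real n"
      using n by (simp add: field_simps)
    then have "\<bar>?g j - (\<Sum>k=1..n. ?g k) / real n\<bar> \<le> 4 * real n"
      using abs_scheffe_score_le[OF assms, of j d] by linarith
    then have "\<bar>(?g j - (\<Sum>k=1..n. ?g k) / real n) / (4 * real n)\<bar> \<le> 1"
      using n by (simp add: abs_divide)
    then have "0 \<le> 1 + (?g j - (\<Sum>k=1..n. ?g k) / real n) / (4 * real n)"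
      "1 + (?g j - (\<Sum>k=1..n. ?g k) / real n) / (4 * real n) \<le> 2"
      by linarith+
    then show ?thesis
      unfolding vote_weight_def using True n by (auto intro!: divide_right_mono divide_nonneg_nonneg)
  qed (auto simp: vote_weight_def)
  then show "0 \<le> vote_weight n C P d j" "vote_weight n C P d j \<le> 2 / real n" by auto
qed

lemma sum_vote_weight:
  assumes "1 \<le> n"
  shows "(\<Sum>j=1..n. vote_weight n C P d j) = 1"
proof -
  have "(\<Sum>j=1..n. vote_weight n C P d j) =
      (\<Sum>j=1..n. (1 + (scheffe_score n C P j d
         - (\<Sum>k=1..n. scheffe_score n C P k d) / real n) / (4 * real n)) / real n)"
    by (intro sum.cong) (auto simp: vote_weight_def)
  also have "\<dots> = 1"
    using assms by (simp add: sum.distrib sum_subtractf flip: sum_divide_distrib)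
  finally show ?thesis .
qed

definition scheffe_vote :: "nat \<Rightarrow> nat \<Rightarrow> (nat \<Rightarrow> nat pmf) \<Rightarrow> nat \<Rightarrow> nat pmf" where
  "scheffe_vote n C P d = embed_pmf (vote_weight n C P d)"

lemma pmf_scheffe_vote:
  assumes "urn_family n C P" "1 \<le> n"
  shows "pmf (scheffe_vote n C P d) j = vote_weight n C P d j"
  unfolding scheffe_vote_def
proof (rule pmf_embed_pmf)
  show "0 \<le> vote_weight n C P d x" for x
    by (rule vote_weight_bounds(1)[OF assms(1)])
  have "(\<integral>\<^sup>+x. ennreal (vote_weight n C P d x) \<partial>count_space UNIV) =
      (\<Sum>x\<in>{1..n}. ennreal (vote_weight n C P d x))"
    by (rule nn_integral_count_space'[of "{1..n}"]) (auto simp: vote_weight_def)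
  also have "\<dots> = 1"
    using assms by (simp add: sum_ennreal vote_weight_bounds sum_vote_weight del: One_nat_def)
  finally show "(\<integral>\<^sup>+x. ennreal (vote_weight n C P d x) \<partial>count_space UNIV) = 1" .
qed

lemma set_pmf_scheffe_vote_subset:
  assumes "urn_family n C P" "1 \<le> n"
  shows "set_pmf (scheffe_vote n C P d) \<subseteq> {1..n}"
  using assms by (auto simp: set_pmf_eq pmf_scheffe_vote vote_weight_def)

lemma pmf_cast_vote:
  assumes "set_pmf Q \<subseteq> {1..C}"
  shows "pmf (cast_vote Q r) j = (\<Sum>d=1..C. pmf Q d * pmf (r d) j)"
  unfolding cast_vote_def pmf_bind using assms
  by (subst integral_measure_pmf[of "{1..C}"]) auto

lemma pmf_cast_scheffe_vote_le:
  assumes "urn_family n C P" "i \<in> {1..n}"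
  shows "pmf (cast_vote (P i) (scheffe_vote n C P)) j \<le> 2 / real n"
proof -
  have Pi: "set_pmf (P i) \<subseteq> {1..C}" and n: "1 \<le> n"
    using assms by (auto simp: urn_family_def)
  have "pmf (cast_vote (P i) (scheffe_vote n C P)) j \<le> (\<Sum>d=1..C. pmf (P i) d * (2 / real n))"
    unfolding pmf_cast_vote[OF Pi] pmf_scheffe_vote[OF assms(1) n]
    by (intro sum_mono mult_left_mono vote_weight_bounds assms) auto
  also have "\<dots> = 2 / real n"
    using Pi by (simp add: sum_pmf_eq_1 flip: sum_distrib_right sum_divide_distrib)
  finally show ?thesis .
qed

lemma pmf_cast_scheffe_vote_gap:
  assumes "urn_family n C P" "i \<in> {1..n}" "j \<in> {1..n}"
  shows "(\<Sum>c=1..C. \<bar>pmf (P i) c - pmf (P j) c\<bar>) / (4 * (real n)\<^sup>2) \<le>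
    pmf (cast_vote (P i) (scheffe_vote n C P)) i - pmf (cast_vote (P i) (scheffe_vote n C P)) j"
proof -
  have Pi: "set_pmf (P i) \<subseteq> {1..C}" and n: "1 \<le> n"
    using assms by (auto simp: urn_family_def)
  \<comment> \<open>The mean score cancels in the difference; the scalings
    \<open>1 / (4 * n)\<close> and \<open>1 / n\<close> multiply to the stated factor.\<close>
  have weight: "vote_weight n C P d i - vote_weight n C P d j =
      (scheffe_score n C P i d - scheffe_score n C P j d) / (4 * (real n)\<^sup>2)" for d
    using assms n by (simp add: vote_weight_def divide_simps power2_eq_square) (simp add: algebra_simps)
  have "(\<Sum>c=1..C. \<bar>pmf (P i) c - pmf (P j) c\<bar>) / (4 * (real n)\<^sup>2) \<le>
      (\<Sum>d=1..C. pmf (P i) d * (scheffe_score n C P i d - scheffe_score n C P j d)) / (4 * (real n)\<^sup>2)"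
    by (intro divide_right_mono expected_scheffe_score_gap assms) auto
  also have "\<dots> = (\<Sum>d=1..C. pmf (P i) d * (vote_weight n C P d i - vote_weight n C P d j))"
    unfolding weight by (simp add: sum_divide_distrib)
  also have "\<dots> = pmf (cast_vote (P i) (scheffe_vote n C P)) i
      - pmf (cast_vote (P i) (scheffe_vote n C P)) j"
    unfolding pmf_cast_vote[OF Pi] pmf_scheffe_vote[OF assms(1) n]
    by (simp add: right_diff_distrib sum_subtractf)
  finally show ?thesis .
qed

section \<open>The minimal l1 distance\<close>

lemma finite_pairwise_l1_dists:
  fixes P :: "nat \<Rightarrow> nat pmf"
  shows "finite {\<Sum>c=1..C. \<bar>pmf (P i) c - pmf (P j) c\<bar> | i j. i \<in> {1..n} \<and> j \<in> {1..n} \<and> i \<noteq> j}"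
proof (rule finite_subset)
  show "{\<Sum>c=1..C. \<bar>pmf (P i) c - pmf (P j) c\<bar> | i j. i \<in> {1..n} \<and> j \<in> {1..n} \<and> i \<noteq> j}
      \<subseteq> (\<lambda>(i, j). \<Sum>c=1..C. \<bar>pmf (P i) c - pmf (P j) c\<bar>) ` ({1..n} \<times> {1..n})"
    by auto
qed auto

lemma min_l1_dist_le:
  assumes "i \<in> {1..n}" "j \<in> {1..n}" "i \<noteq> j"
  shows "min_l1_dist n C P \<le> (\<Sum>c=1..C. \<bar>pmf (P i) c - pmf (P j) c\<bar>)"
  unfolding min_l1_dist_def using assms by (intro Min_le finite_pairwise_l1_dists) blast

lemma min_l1_dist_attained:
  assumes "2 \<le> n"
  obtains i j where "i \<in> {1..n}" "j \<in> {1..n}" "i \<noteq> j"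
    "min_l1_dist n C P = (\<Sum>c=1..C. \<bar>pmf (P i) c - pmf (P j) c\<bar>)"
proof -
  let ?S = "{\<Sum>c=1..C. \<bar>pmf (P i) c - pmf (P j) c\<bar> | i j. i \<in> {1..n} \<and> j \<in> {1..n} \<and> i \<noteq> j}"
  have "1 \<in> {1..n}" "2 \<in> {1..n}" "(1::nat) \<noteq> 2"
    using assms by auto
  then have "?S \<noteq> {}" by blast
  then have "Min ?S \<in> ?S"
    by (intro Min_in finite_pairwise_l1_dists)
  then show ?thesis
    using that unfolding min_l1_dist_def by blast
qed

text \<open>At distance zero the two urns agree on the colors \<open>1..C\<close>; both vanish
  elsewhere, so they would coincide, against injectivity of \<open>P\<close>.\<close>

lemma min_l1_dist_pos:
  assumes "2 \<le> n" "urn_family n C P"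
  shows "0 < min_l1_dist n C P"
proof -
  obtain i j where ij: "i \<in> {1..n}" "j \<in> {1..n}" "i \<noteq> j"
    "min_l1_dist n C P = (\<Sum>c=1..C. \<bar>pmf (P i) c - pmf (P j) c\<bar>)"
    by (rule min_l1_dist_attained[OF assms(1)])
  have "(\<Sum>c=1..C. \<bar>pmf (P i) c - pmf (P j) c\<bar>) \<noteq> 0"
  proof
    assume "(\<Sum>c=1..C. \<bar>pmf (P i) c - pmf (P j) c\<bar>) = 0"
    then have eq: "pmf (P i) c = pmf (P j) c" if "c \<in> {1..C}" for c
      using that by (simp add: sum_nonneg_eq_0_iff)
    have "pmf (P k) c = 0" if "c \<notin> {1..C}" "k \<in> {1..n}" for c k
      using assms(2) that by (meson pmf_eq_0_set_pmf subsetD urn_family_def)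
    then have "P i = P j"
      using eq ij(1,2) by (intro pmf_eqI) metis
    then show False
      using assms(2) ij(1-3) by (meson inj_onD urn_family_def)
  qed
  moreover have "0 \<le> (\<Sum>c=1..C. \<bar>pmf (P i) c - pmf (P j) c\<bar>)"
    by (simp add: sum_nonneg)
  ultimately show ?thesis
    using ij(4) by linarith
qed

text \<open>Triangle inequality for two distributions of mass 1. The bound serves to keep the
  Chernoff parameter at most 1 and \<open>voter_bound\<close> at least 1.\<close>

lemma min_l1_dist_le_2:
  assumes "2 \<le> n" "urn_family n C P"
  shows "min_l1_dist n C P \<le> 2"
proof -
  obtain i j where ij: "i \<in> {1..n}" "j \<in> {1..n}"
    "min_l1_dist n C P = (\<Sum>c=1..C. \<bar>pmf (P i) c - pmf (P j) c\<bar>)"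
    by (rule min_l1_dist_attained[OF assms(1)])
  have "(\<Sum>c=1..C. \<bar>pmf (P i) c - pmf (P j) c\<bar>) \<le> (\<Sum>c=1..C. pmf (P i) c + pmf (P j) c)"
    by (intro sum_mono order_trans[OF abs_triangle_ineq4]) simp
  also have "\<dots> = 2"
    using assms(2) ij(1,2) by (simp add: sum.distrib sum_pmf_eq_1 urn_family_def)
  finally show ?thesis
    using ij(3) by simp
qed

section \<open>The number of voters\<close>

lemma voter_bound_ge:
  assumes "2 \<le> n" "2 \<le> C" "0 < \<eta>" "\<eta> < 1"
  shows "real n ^ 3 / \<epsilon>\<^sup>2 * ln (real n / \<eta>) \<le> voter_bound n C \<epsilon> \<eta>"
proof -
  have "ln 2 \<le> ln (real C)"
    using assms(2) by simp
  then have "1 / 2 \<le> ln (real C)"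
    using ln2_ge_two_thirds by linarith
  then have "2 * (1 / 2) \<le> real C * ln (real C)"
    using assms(2) by (intro mult_mono) auto
  then have "1 * (real n ^ 3 / \<epsilon>\<^sup>2 * ln (real n / \<eta>)) \<le>
      (real C * ln (real C))\<^sup>2 * (real n ^ 3 / \<epsilon>\<^sup>2 * ln (real n / \<eta>))"
    using assms by (intro mult_right_mono) (auto simp: one_le_power)
  then show ?thesis
    by (simp add: voter_bound_def)
qed

text \<open>This allows rounding up to an integer number of voters at the price of a constant
  factor. The cubic quotient is at least 2 and the logarithm at least \<open>1 / 2\<close>.\<close>

lemma voter_bound_ge_1:
  assumes "2 \<le> n" "2 \<le> C" "0 < \<eta>" "\<eta> < 1" "0 < \<epsilon>" "\<epsilon> \<le> 2"
  shows "1 \<le> voter_bound n C \<epsilon> \<eta>"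
proof -
  have "2 * 1 \<le> real n * (1 / \<eta>)"
    using assms by (intro mult_mono) auto
  then have "ln 2 \<le> ln (real n / \<eta>)"
    by (intro ln_mono) auto
  then have "1 / 2 \<le> ln (real n / \<eta>)"
    using ln2_ge_two_thirds by linarith
  moreover have "2 ^ 3 / 2\<^sup>2 \<le> real n ^ 3 / \<epsilon>\<^sup>2"
    using assms by (intro frac_le power_mono) auto
  ultimately have "2 * (1 / 2) \<le> real n ^ 3 / \<epsilon>\<^sup>2 * ln (real n / \<eta>)"
    by (intro mult_mono) auto
  then show ?thesis
    using voter_bound_ge[OF assms(1-4), of \<epsilon>] by linarith
qed

text \<open>With this many voters each competitor ties or beats urn \<open>i\<close> with
  probability at most \<open>\<eta> / n\<close>, which the union bound turns into
  \<open>\<eta>\<close>.\<close>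

lemma scheffe_vote_wins:
  assumes "2 \<le> n" "urn_family n C P" "0 < \<eta>" "i \<in> {1..n}"
    and m: "256 * (real n ^ 3 / (min_l1_dist n C P)\<^sup>2 * ln (real n / \<eta>)) \<le> real m"
  shows "1 - \<eta> \<le> measure_pmf.prob (ballots m (\<lambda>_. scheffe_vote n C P) (P i))
    {v. plurality_winner n m v i}"
proof -
  define \<epsilon> where "\<epsilon> = min_l1_dist n C P"
  \<comment> \<open>This \<open>t\<close> is \<open>\<Delta> / (2 * s)\<close> with
    \<open>s = 4 / n\<close>, the minimiser of \<open>- (t * \<Delta>) + t\<^sup>2 * s\<close>. The
    minimum \<open>- \<Delta>\<^sup>2 / (4 * s)\<close> is the source of the constant 256.\<close>
  define t where "t = \<epsilon> / (32 * real n)"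
  define \<Delta> where "\<Delta> = \<epsilon> / (4 * (real n)\<^sup>2)"
  define Q where "Q = cast_vote (P i) (scheffe_vote n C P)"
  have \<epsilon>: "0 < \<epsilon>" "\<epsilon> \<le> 2"
    unfolding \<epsilon>_def using assms min_l1_dist_pos min_l1_dist_le_2 by auto
  have n: "real n \<ge> 2" using assms(1) by simp
  have t: "0 \<le> t" "t \<le> 1"
    using \<epsilon> n by (auto simp: t_def)
  have gap: "\<Delta> \<le> pmf Q i - pmf Q j" if "j \<in> {1..n}" "j \<noteq> i" for j
  proof -
    have "\<Delta> \<le> (\<Sum>c=1..C. \<bar>pmf (P i) c - pmf (P j) c\<bar>) / (4 * (real n)\<^sup>2)"
      unfolding \<Delta>_def \<epsilon>_def using that assms(4) by (intro divide_right_mono min_l1_dist_le) auto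
    also have "\<dots> \<le> pmf Q i - pmf Q j"
      unfolding Q_def using that assms by (intro pmf_cast_scheffe_vote_gap) auto
    finally show ?thesis .
  qed
  have small: "pmf Q i + pmf Q j \<le> 4 / real n" for j
    using pmf_cast_scheffe_vote_le[OF assms(2,4), of i] pmf_cast_scheffe_vote_le[OF assms(2,4), of j]
    by (simp add: Q_def)
  have exponent: "- (t * \<Delta>) + t\<^sup>2 * (4 / real n) = - (\<epsilon>\<^sup>2 / (256 * real n ^ 3))"
    using n by (simp add: t_def \<Delta>_def field_simps power2_eq_square power3_eq_cube)
  have "ln (real n / \<eta>) =
      256 * (real n ^ 3 / \<epsilon>\<^sup>2 * ln (real n / \<eta>)) * (\<epsilon>\<^sup>2 / (256 * real n ^ 3))"
    using n \<epsilon> by simp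
  also have "\<dots> \<le> real m * (\<epsilon>\<^sup>2 / (256 * real n ^ 3))"
    using m unfolding \<epsilon>_def[symmetric] by (intro mult_right_mono) auto
  finally have "exp (real m * (- (t * \<Delta>) + t\<^sup>2 * (4 / real n))) \<le> exp (- ln (real n / \<eta>))"
    unfolding exponent by simp
  also have "\<dots> = \<eta> / real n"
    using n assms(3) by (simp add: exp_minus)
  finally have "real n * exp (real m * (- (t * \<Delta>) + t\<^sup>2 * (4 / real n))) \<le> \<eta>"
    using n by (simp add: field_simps)
  moreover have "1 - real n * exp (real m * (- (t * \<Delta>) + t\<^sup>2 * (4 / real n))) \<le>
      measure_pmf.prob (Pi_pmf {1..m} 0 (\<lambda>_. Q)) {v. plurality_winner n m v i}"
    by (rule prob_plurality_winner_ge[OF assms(4) t gap small])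
  ultimately show ?thesis
    by (simp add: ballots_def Q_def)
qed

theorem theorem6:
  "\<exists>a b :: real. 0 < a \<and> a \<le> b \<and>
     (\<forall>(n::nat) (C::nat) (P :: nat \<Rightarrow> nat pmf) (\<eta>::real).
        2 \<le> n \<longrightarrow> 2 \<le> C \<longrightarrow> urn_family n C P \<longrightarrow> 0 < \<eta> \<longrightarrow> \<eta> < 1 \<longrightarrow>
        (\<exists>(m::nat) (\<sigma> :: nat \<Rightarrow> nat \<Rightarrow> nat pmf).
           a * voter_bound n C (min_l1_dist n C P) \<eta> \<le> real m \<and>
           real m \<le> b * voter_bound n C (min_l1_dist n C P) \<eta> \<and>
           voting_scheme n C m \<sigma> \<and>
           (\<forall>i\<in>{1..n}.
              measure_pmf.prob (ballots m \<sigma> (P i)) {v. plurality_winner n m v i} \<ge> 1 - \<eta>)))"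
proof (rule exI[of _ 256], rule exI[of _ 257], intro conjI allI impI)
  fix n C :: nat and P :: "nat \<Rightarrow> nat pmf" and \<eta> :: real
  assume *: "2 \<le> n" "2 \<le> C" "urn_family n C P" "0 < \<eta>" "\<eta> < 1"
  define V where "V = voter_bound n C (min_l1_dist n C P) \<eta>"
  \<comment> \<open>Rounding up adds less than 1, and \<open>1 \<le> V\<close>, so the upper
    constant 257 absorbs it. All voters use the same rule.\<close>
  define m where "m = nat \<lceil>256 * V\<rceil>"
  have V: "1 \<le> V"
    unfolding V_def by (intro voter_bound_ge_1 min_l1_dist_pos min_l1_dist_le_2 *)
  then have m: "256 * V \<le> real m" "real m \<le> 257 * V"
    unfolding m_def by linarith+
  moreover have "voting_scheme n C m (\<lambda>_. scheffe_vote n C P)"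
    unfolding voting_scheme_def using set_pmf_scheffe_vote_subset[OF *(3)] *(1) by simp
  moreover have "256 * (real n ^ 3 / (min_l1_dist n C P)\<^sup>2 * ln (real n / \<eta>)) \<le> real m"
    using voter_bound_ge[OF *(1,2,4,5), of "min_l1_dist n C P"] m(1) by (simp add: V_def)
  then have "\<forall>i\<in>{1..n}. measure_pmf.prob (ballots m (\<lambda>_. scheffe_vote n C P) (P i))
      {v. plurality_winner n m v i} \<ge> 1 - \<eta>"
    using scheffe_vote_wins[OF *(1,3,4)] by blast
  ultimately show "\<exists>m \<sigma>. 256 * voter_bound n C (min_l1_dist n C P) \<eta> \<le> real m \<and>
      real m \<le> 257 * voter_bound n C (min_l1_dist n C P) \<eta> \<and> voting_scheme n C m \<sigma> \<and>
      (\<forall>i\<in>{1..n}. measure_pmf.prob (ballots m \<sigma> (P i)) {v. plurality_winner n m v i} \<ge> 1 - \<eta>)"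
    unfolding V_def by blast
qed auto

end
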